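(* Let $k\in\mathbb{N}$ and, for real $R\ge0$, let $B_{k,1}(R):=\{a\in\mathbb{Z}^k:\sum_{i=1}^k|a_i|\le R\}$. For all $R\ge0$, $$2^{\min\{k,R\}}\binom{\lfloor R\rfloor}{k}\mathbf{1}(R\ge k)\;\le\;|B_{k,1}(R)|\;\le\;2^{\min\{k,R\}}\binom{\lfloor R\rfloor+k}{k}.$$
   Context: $|B|$ denotes the number of elements of a finite set $B$, and $\mathbf{1}(\cdot)$ is the indicator function. *)

theory Defs
  imports "HOL-Analysis.Analysis" "HOL-Library.FuncSet"
begin

text \<open>
  Elements of \<open>\<int>\<^sup>k\<close> are the functions on \<open>{1..k}\<close> that are \<^const>\<open>undefined\<close>
  elsewhere, so that distinct functions in the ball are distinct lattice points.
\<close>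

definition int_l1_ball :: "nat \<Rightarrow> real \<Rightarrow> (nat \<Rightarrow> int) set" where
  "int_l1_ball k R =
     {a \<in> {1..k} \<rightarrow>\<^sub>E (UNIV :: int set). real_of_int (\<Sum>i = 1..k. \<bar>a i\<bar>) \<le> R}"

text \<open>By the next fact, \<^const>\<open>card\<close> of a ball is its true number of elements.\<close>

lemma finite_int_l1_ball: "finite (int_l1_ball k R)"
proof (rule finite_subset)
  show "int_l1_ball k R \<subseteq> {1..k} \<rightarrow>\<^sub>E {- \<lfloor>R\<rfloor>..\<lfloor>R\<rfloor>}"
  proof
    fix a assume a: "a \<in> int_l1_ball k R"
    have ext: "a \<in> extensional {1..k}"
      and le: "(\<Sum>i = 1..k. \<bar>a i\<bar>) \<le> \<lfloor>R\<rfloor>"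
      using a unfolding int_l1_ball_def le_floor_iff PiE_def by blast+
    have "a i \<in> {- \<lfloor>R\<rfloor>..\<lfloor>R\<rfloor>}" if "i \<in> {1..k}" for i
    proof -
      have "\<bar>a i\<bar> \<le> (\<Sum>i = 1..k. \<bar>a i\<bar>)"
        using that by (rule member_le_sum) simp_all
      with le have "\<bar>a i\<bar> \<le> \<lfloor>R\<rfloor>" by (rule order_trans[rotated])
      then show ?thesis by auto
    qed
    with ext show "a \<in> {1..k} \<rightarrow>\<^sub>E {- \<lfloor>R\<rfloor>..\<lfloor>R\<rfloor>}"
      unfolding PiE_def by blast
  qed
qed (simp add: finite_PiE)

end

theory Submission
  imports Defs
begin

text \<open>
  Only \<open>n = \<lfloor>R\<rfloor>\<close> matters, and the number \<open>D k n\<close> of lattice points of the ball of radius \<open>n\<close>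
  in dimension \<open>k\<close> is a Delannoy number:
  \<open>D (k+1) (n+1) = D k (n+1) + D (k+1) n + D k n\<close> (\<open>card_ball_Suc_Suc\<close>).  The first summand counts
  the points whose last coordinate is \<open>0\<close>.  Moving a nonzero last coordinate one step towards \<open>0\<close>
  maps the other points onto the ball of radius \<open>n\<close>, and precisely the \<open>D k n\<close> points with last
  coordinate \<open>0\<close> are hit twice.

  Both bounds then follow by induction along this recurrence and Pascal's rule (\<open>card_ball_lower\<close>,
  \<open>card_ball_upper\<close>).  Behind the factors of two are the sign choices: a point with \<open>s\<close> nonzero
  coordinates has \<open>2^s\<close> reflections.  There are \<open>n choose k\<close> points with all coordinates
  positive, where \<open>s = k\<close>, and \<open>n + k choose k\<close> points with nonnegative coordinates, where always
  \<open>s \<le> min k n\<close>.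
\<close>

lemma mem_ball_nat:
  "a \<in> int_l1_ball k (real n) \<longleftrightarrow> a \<in> extensional {1..k} \<and> (\<Sum>i = 1..k. \<bar>a i\<bar>) \<le> int n"
proof -
  have "real_of_int (\<Sum>i = 1..k. \<bar>a i\<bar>) \<le> real n \<longleftrightarrow> (\<Sum>i = 1..k. \<bar>a i\<bar>) \<le> int n"
    by (metis of_int_le_iff of_int_of_nat_eq)
  then show ?thesis
    by (simp add: int_l1_ball_def PiE_def)
qed

lemma mem_ball_Suc:
  "a \<in> int_l1_ball (Suc k) (real n) \<longleftrightarrow>
     a \<in> extensional {1..Suc k} \<and> (\<Sum>i = 1..k. \<bar>a i\<bar>) + \<bar>a (Suc k)\<bar> \<le> int n"
  unfolding mem_ball_nat by simp

lemma ball_eq_ball_floor: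
  assumes "R \<ge> 0"
  shows "int_l1_ball k R = int_l1_ball k (real (nat \<lfloor>R\<rfloor>))"
proof -
  have "real_of_int s \<le> R \<longleftrightarrow> real_of_int s \<le> real (nat \<lfloor>R\<rfloor>)" for s
    using assms by (simp add: le_floor_iff)
  then show ?thesis
    unfolding int_l1_ball_def by blast
qed

lemma card_ball_dim_0: "card (int_l1_ball 0 (real n)) = 1"
proof -
  have "int_l1_ball 0 (real n) = {\<lambda>_. undefined}"
    by (auto simp: int_l1_ball_def)
  then show ?thesis by simp
qed

lemma card_ball_radius_0: "card (int_l1_ball k (real 0)) = 1"
proof -
  have "(\<Sum>i = 1..k. \<bar>a i\<bar>) \<le> 0 \<longleftrightarrow> (\<forall>i\<in>{1..k}. a i = 0)" for a :: "nat \<Rightarrow> int"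
  proof -
    have "(\<Sum>i = 1..k. \<bar>a i\<bar>) \<ge> 0"
      by (rule sum_nonneg) simp
    then have "(\<Sum>i = 1..k. \<bar>a i\<bar>) \<le> 0 \<longleftrightarrow> (\<Sum>i = 1..k. \<bar>a i\<bar>) = 0"
      by linarith
    also have "\<dots> \<longleftrightarrow> (\<forall>i\<in>{1..k}. a i = 0)"
      by (subst sum_nonneg_eq_0_iff) auto
    finally show ?thesis .
  qed
  then have "int_l1_ball k (real 0) = {\<lambda>i\<in>{1..k}. 0}"
    unfolding set_eq_iff mem_ball_nat by (auto simp: extensional_def fun_eq_iff)
  then show ?thesis by simp
qed

lemma card_ball_last_eq_0:
  "card {a \<in> int_l1_ball (Suc k) (real n). a (Suc k) = 0} = card (int_l1_ball k (real n))"
proof (rule bij_betw_same_card[symmetric])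
  show "bij_betw (\<lambda>a. a(Suc k := 0)) (int_l1_ball k (real n))
          {a \<in> int_l1_ball (Suc k) (real n). a (Suc k) = 0}"
    by (rule bij_betw_byWitness[where f' = "\<lambda>a. a(Suc k := undefined)"])
       (auto simp: mem_ball_Suc mem_ball_nat extensional_def fun_eq_iff)
qed

text \<open>
  Moving the last coordinate by \<open>- s\<close>, that is, one step towards \<open>0\<close>, lowers the norm by one.
  The sign \<open>s\<close> treats the positive and the negative side at once.
\<close>

lemma card_ball_last_side:
  fixes s :: int
  assumes "s = 1 \<or> s = -1"
  shows "card {a \<in> int_l1_ball (Suc k) (real (Suc n)). s * a (Suc k) > 0} =
         card {a \<in> int_l1_ball (Suc k) (real n). s * a (Suc k) \<ge> 0}"
proof (rule bij_betw_same_card)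
  show "bij_betw (\<lambda>a. a(Suc k := a (Suc k) - s))
          {a \<in> int_l1_ball (Suc k) (real (Suc n)). s * a (Suc k) > 0}
          {a \<in> int_l1_ball (Suc k) (real n). s * a (Suc k) \<ge> 0}"
    by (rule bij_betw_byWitness[where f' = "\<lambda>a. a(Suc k := a (Suc k) + s)"])
       (use assms in \<open>auto simp: mem_ball_Suc extensional_def fun_eq_iff simp del: of_nat_Suc\<close>)
qed

lemma card_ball_Suc_Suc:
  "card (int_l1_ball (Suc k) (real (Suc n))) =
     card (int_l1_ball k (real (Suc n))) + card (int_l1_ball (Suc k) (real n))
       + card (int_l1_ball k (real n))"
proof -
  define B where "B = int_l1_ball (Suc k) (real n)"
  define B' where "B' = int_l1_ball (Suc k) (real (Suc n))"
  have fin: "finite B" "finite B'"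
    by (simp_all add: B_def B'_def finite_int_l1_ball del: of_nat_Suc)
  define pos neg where "pos = {a \<in> B. a (Suc k) \<ge> 0}" and "neg = {a \<in> B. a (Suc k) \<le> 0}"
  have "B' = {a \<in> B'. a (Suc k) = 0} \<union> ({a \<in> B'. a (Suc k) > 0} \<union> {a \<in> B'. a (Suc k) < 0})"
    by auto
  also have "card \<dots> = card {a \<in> B'. a (Suc k) = 0}
      + (card {a \<in> B'. a (Suc k) > 0} + card {a \<in> B'. a (Suc k) < 0})"
    using fin by (subst card_Un_disjoint; auto)+
  also have "card {a \<in> B'. a (Suc k) > 0} = card pos"
    using card_ball_last_side[of 1 k n] by (simp add: B_def B'_def pos_def)
  also have "card {a \<in> B'. a (Suc k) < 0} = card neg"
    using card_ball_last_side[of "-1" k n] by (simp add: B_def B'_def neg_def)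
  also have "card pos + card neg = card (pos \<union> neg) + card (pos \<inter> neg)"
    using fin by (intro card_Un_Int) (auto simp: pos_def neg_def)
  also have "pos \<union> neg = B"
    by (auto simp: pos_def neg_def)
  also have "pos \<inter> neg = {a \<in> B. a (Suc k) = 0}"
    by (auto simp: pos_def neg_def)
  finally show ?thesis
    unfolding B_def B'_def card_ball_last_eq_0 by simp
qed

lemma card_ball_lower: "2 ^ k * (n choose k) \<le> card (int_l1_ball k (real n))"
proof (induction "k + n" arbitrary: k n rule: less_induct)
  case less
  show ?case
  proof (cases "k = 0 \<or> n = 0")
    case True
    then show ?thesis
      using card_ball_dim_0[of n] card_ball_radius_0[of k] by (cases k) auto
  next
    case False
    then obtain l m where kn: "k = Suc l" "n = Suc m"
      using not0_implies_Suc by blast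
    have "2 ^ Suc l * (Suc m choose Suc l) = 2 ^ l * (m choose l) + 2 ^ l * (m choose l)
            + 2 ^ Suc l * (m choose Suc l)"
      by (simp add: algebra_simps)
    also have "\<dots> \<le> 2 ^ l * (Suc m choose l) + 2 ^ l * (m choose l) + 2 ^ Suc l * (m choose Suc l)"
      by (intro add_mono mult_mono binomial_right_mono) simp_all
    also have "\<dots> \<le> card (int_l1_ball (Suc l) (real (Suc m)))"
      using less[of l "Suc m"] less[of l m] less[of "Suc l" m]
      unfolding card_ball_Suc_Suc kn by linarith
    finally show ?thesis unfolding kn .
  qed
qed

lemma card_ball_upper: "card (int_l1_ball k (real n)) \<le> 2 ^ min k n * ((n + k) choose k)"
proof (induction "k + n" arbitrary: k n rule: less_induct)
  case less
  show ?case
  proof (cases "k = 0 \<or> n = 0")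
    case True
    then show ?thesis
      using card_ball_dim_0[of n] card_ball_radius_0[of k] by auto
  next
    case False
    then obtain l m where kn: "k = Suc l" "n = Suc m"
      using not0_implies_Suc by blast
    define p where "p = (2::nat) ^ min l m"
    define u v w where "u = Suc (m + l) choose l" and "v = Suc (m + l) choose Suc l"
      and "w = (m + l) choose l"
    have w: "w \<le> u" "w \<le> v"
      by (simp_all add: u_def v_def w_def binomial_right_mono)
    have a: "card (int_l1_ball l (real (Suc m))) \<le> 2 ^ min l (Suc m) * u"
      and b: "card (int_l1_ball (Suc l) (real m)) \<le> 2 ^ min (Suc l) m * v"
      and c: "card (int_l1_ball l (real m)) \<le> p * w"
      using less[of l "Suc m"] less[of "Suc l" m] less[of l m]
      by (simp_all add: kn u_def v_def w_def p_def del: binomial_Suc_Suc of_nat_Suc)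
    \<comment> \<open>At most one of the factors of \<open>u\<close> and \<open>v\<close> is \<open>2 * p\<close>;
        the other one is \<open>p\<close> and leaves room for the term \<open>p * w\<close>.\<close>
    consider "l \<le> m" | "m < l" by linarith
    then have "2 ^ min l (Suc m) * u + 2 ^ min (Suc l) m * v + p * w \<le> 2 * p * (u + v)"
    proof cases
      case 1
      then have "2 ^ min l (Suc m) * u = p * u" by (simp add: p_def)
      moreover have "(2::nat) ^ min (Suc l) m \<le> 2 ^ Suc (min l m)"
        by (intro power_increasing) auto
      then have "2 ^ min (Suc l) m * v \<le> 2 * p * v" by (simp add: p_def)
      moreover have "p * w \<le> p * u" using w by simp
      ultimately show ?thesis unfolding add_mult_distrib2 mult.assoc by linarith
    next
      case 2
      then have "2 ^ min (Suc l) m * v = p * v" by (simp add: p_def)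
      moreover have "(2::nat) ^ min l (Suc m) \<le> 2 ^ Suc (min l m)"
        by (intro power_increasing) auto
      then have "2 ^ min l (Suc m) * u \<le> 2 * p * u" by (simp add: p_def)
      moreover have "p * w \<le> p * v" using w by simp
      ultimately show ?thesis unfolding add_mult_distrib2 mult.assoc by linarith
    qed
    with a b c have "card (int_l1_ball (Suc l) (real (Suc m))) \<le> 2 * p * (u + v)"
      unfolding card_ball_Suc_Suc by linarith
    also have "\<dots> = 2 ^ min k n * ((n + k) choose k)"
      by (simp add: kn p_def u_def v_def)
    finally show ?thesis unfolding kn .
  qed
qed

theorem lemmaE:
  fixes k :: nat and R :: real
  assumes "R \<ge> 0"
  shows "2 powr (min (real k) R) * real (nat \<lfloor>R\<rfloor> choose k) * of_bool (R \<ge> real k)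
           \<le> real (card (int_l1_ball k R))
       \<and> real (card (int_l1_ball k R))
           \<le> 2 powr (min (real k) R) * real ((nat \<lfloor>R\<rfloor> + k) choose k)"
proof
  define n where "n = nat \<lfloor>R\<rfloor>"
  have ball: "int_l1_ball k R = int_l1_ball k (real n)"
    unfolding n_def by (rule ball_eq_ball_floor[OF assms])
  have "2 powr (min (real k) R) * real (n choose k) * of_bool (R \<ge> real k)
          \<le> real (2 ^ k * (n choose k))"
    by (auto simp: powr_realpow)
  also have "\<dots> \<le> real (card (int_l1_ball k R))"
    unfolding ball of_nat_le_iff by (rule card_ball_lower)
  finally show "2 powr (min (real k) R) * real (nat \<lfloor>R\<rfloor> choose k) * of_bool (R \<ge> real k)
      \<le> real (card (int_l1_ball k R))"
    unfolding n_def .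
  have "real n \<le> R"
    using assms by (simp add: n_def)
  then have "(2::real) powr real (min k n) \<le> 2 powr (min (real k) R)"
    by (intro powr_mono) auto
  then have pow: "(2::real) ^ min k n \<le> 2 powr (min (real k) R)"
    by (simp add: powr_realpow del: of_nat_min)
  have "real (card (int_l1_ball k R)) \<le> real (2 ^ min k n * ((n + k) choose k))"
    unfolding ball of_nat_le_iff by (rule card_ball_upper)
  also have "\<dots> = 2 ^ min k n * real ((n + k) choose k)"
    by simp
  also have "\<dots> \<le> 2 powr (min (real k) R) * real ((n + k) choose k)"
    by (intro mult_right_mono pow) simp
  finally show "real (card (int_l1_ball k R))
      \<le> 2 powr (min (real k) R) * real ((nat \<lfloor>R\<rfloor> + k) choose k)"
    unfolding n_def .
qed

end
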